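(* Let $\Delta<0$ be a discriminant with class number $h(\Delta)\geq 2$, and let $S_\Delta=\{Q_1,\ldots,Q_{h(\Delta)}\}$ be the set of all forms of discriminant $\Delta$. For $i\neq j$ define the quaternary quadratic form $Q_{ij}(x,y,z,w):=Q_i(x,y)-Q_j(z,w)$. Then the only non-negative integer $m$ represented by all $Q\in S_\Delta$ is $m=0$ if and only if at least one of the $Q_{ij}$ (with $i\neq j$) is anisotropic.
   Context: Conventions: "form" means an integral, binary, positive definite, primitive, reduced quadratic form $Q(x,y)=ax^2+bxy+cy^2$ with $a,b,c\in\mathbb{Z}$. Primitive means $\gcd(a,b,c)=1$; reduced means $|b|\leq a\leq c$, and $b\geq 0$ if $|b|=a$ or $a=c$. The discriminant is $\Delta=b^2-4ac$. $Q$ represents an integer $m$ if $Q(x,y)=m$ for some $x,y\in\mathbb{Z}$ (so every form represents $0$). The set $S_\Delta$ of forms of discriminant $\Delta$ is finite and contains exactly one form in each proper equivalence class ($\mathrm{SL}_2(\mathbb{Z})$-class) of primitive positive definite binary quadratic forms of discriminant $\Delta$; $h(\Delta)=|S_\Delta|$ is the class number. A quadratic form $F$ in $n$ variables is anisotropic if $F(\vec{x})\neq 0$ for all nonzero $\vec{x}\in\mathbb{Z}^n$. *)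

theory Defs
  imports "HOL-Analysis.Finite_Cartesian_Product" "HOL-Library.Numeral_Type"
begin

text \<open>\<open>BQF a b c\<close> stands for the integral binary quadratic form
  \<open>a x\<^sup>2 + b x y + c y\<^sup>2\<close>.\<close>

datatype bqf = BQF (coeff_a: int) (coeff_b: int) (coeff_c: int)

definition bqf_eval :: "bqf \<Rightarrow> int \<Rightarrow> int \<Rightarrow> int" where
  "bqf_eval Q x y = coeff_a Q * x\<^sup>2 + coeff_b Q * x * y + coeff_c Q * y\<^sup>2"

definition bqf_disc :: "bqf \<Rightarrow> int" where
  "bqf_disc Q = (coeff_b Q)\<^sup>2 - 4 * coeff_a Q * coeff_c Q"

definition bqf_pos_def :: "bqf \<Rightarrow> bool" where
  "bqf_pos_def Q \<longleftrightarrow> (\<forall>x y. (x, y) \<noteq> (0, 0) \<longrightarrow> bqf_eval Q x y > 0)"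

definition bqf_primitive :: "bqf \<Rightarrow> bool" where
  "bqf_primitive Q \<longleftrightarrow> Gcd {coeff_a Q, coeff_b Q, coeff_c Q} = 1"

definition bqf_reduced :: "bqf \<Rightarrow> bool" where
  "bqf_reduced Q \<longleftrightarrow>
     \<bar>coeff_b Q\<bar> \<le> coeff_a Q \<and> coeff_a Q \<le> coeff_c Q \<and>
     (\<bar>coeff_b Q\<bar> = coeff_a Q \<or> coeff_a Q = coeff_c Q \<longrightarrow> coeff_b Q \<ge> 0)"

definition forms :: "int \<Rightarrow> bqf set" where
  "forms D = {Q. bqf_pos_def Q \<and> bqf_primitive Q \<and> bqf_reduced Q \<and> bqf_disc Q = D}"

definition class_number :: "int \<Rightarrow> nat" where
  "class_number D = card (forms D)"

definition represents :: "bqf \<Rightarrow> int \<Rightarrow> bool" where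
  "represents Q m \<longleftrightarrow> (\<exists>x y. bqf_eval Q x y = m)"

definition anisotropic :: "(int ^ 'n \<Rightarrow> int) \<Rightarrow> bool" where
  "anisotropic F \<longleftrightarrow> (\<forall>v. v \<noteq> 0 \<longrightarrow> F v \<noteq> 0)"

text \<open>The quaternary form \<open>Q(x, y) - R(z, w)\<close>, with \<open>(x, y, z, w)\<close> the components
  \<open>1, 2, 3, 4\<close> of the argument. In the index type \<open>4\<close> the numeral \<open>4\<close> equals \<open>0\<close>,
  so these four indices are distinct and exhaust the type.\<close>

definition diff_form :: "bqf \<Rightarrow> bqf \<Rightarrow> int ^ 4 \<Rightarrow> int" where
  "diff_form Q R v = bqf_eval Q (v $ 1) (v $ 2) - bqf_eval R (v $ 3) (v $ 4)"

end

theory Submission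
  imports Defs "HOL-Analysis.Cartesian_Space"
begin

text \<open>
  For positive definite \<open>Q\<close> and \<open>R\<close>, the difference \<open>Q(x, y) - R(z, w)\<close> has a nontrivial zero
  exactly when \<open>Q\<close> and \<open>R\<close> represent a common positive integer
  (\<open>isotropic_iff_common_positive_value\<close>). So an anisotropic difference rules out a common positive
  value of all forms, and the content of the theorem is the converse: \<^emph>\<open>pairwise\<close> common values
  have to be merged into \<^emph>\<open>one\<close> value common to all forms.

  The reason this works is that each form of discriminant \<open>D\<close> is, over the rationals, equivalent to
  a multiple of the norm form of \<open>\<rat>(\<surd>D)\<close>. If \<open>Q\<close> and \<open>R\<close> share a nonzero value then these
  multiples lie in the same class of rationals modulo norms, so \<open>Q\<close> and \<open>R\<close> are rationally
  equivalent; in particular \<open>R\<close> represents the leading coefficient \<open>a\<close> of \<open>Q\<close> over the rationals.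
  Clearing denominators, \<open>R\<close> represents \<open>a\<close> times a nonzero square over the integers
  (\<open>common_value_imp_represents_leading_coeff_times_square\<close>). Fix \<open>Q\<close> and let \<open>R\<close> vary over the
  finitely many forms: \<open>a\<close> times the product of all these squares is represented by every form,
  because multiplying a represented number by a square keeps it represented.
\<close>

text \<open>A nontrivial zero only makes one of the two binary vectors nonzero, but definiteness makes
  the common value positive, and then the other vector is nonzero as well.\<close>

lemma isotropic_iff_common_positive_value:
  assumes "bqf_pos_def Q" and "bqf_pos_def R"
  shows "\<not> anisotropic (diff_form Q R) \<longleftrightarrow> (\<exists>m>0. represents Q m \<and> represents R m)"
proof
  assume "\<not> anisotropic (diff_form Q R)"
  then obtain v :: "int ^ 4" where "v \<noteq> 0" and zero: "diff_form Q R v = 0"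
    by (auto simp: anisotropic_def)
  let ?m = "bqf_eval Q (v $ 1) (v $ 2)"
  have m_R: "?m = bqf_eval R (v $ 3) (v $ 4)"
    using zero by (simp add: diff_form_def)
  have "(v $ 1, v $ 2) \<noteq> (0, 0) \<or> (v $ 3, v $ 4) \<noteq> (0, 0)"
  proof (rule ccontr)
    assume *: "\<not> ?thesis"
    have "v $ i = 0" for i
      using * exhaust_4[of i] by auto
    then show False
      using \<open>v \<noteq> 0\<close> by (simp add: vec_eq_iff)
  qed
  then have "?m > 0"
    using assms m_R unfolding bqf_pos_def_def by metis
  then show "\<exists>m>0. represents Q m \<and> represents R m"
    using m_R unfolding represents_def by metis
next
  assume "\<exists>m>0. represents Q m \<and> represents R m"
  then obtain m x y z w where "m > 0"
    and Q: "bqf_eval Q x y = m" and R: "bqf_eval R z w = m"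
    by (auto simp: represents_def)
  define v :: "int ^ 4"
    where "v = (\<chi> i. if i = 1 then x else if i = 2 then y else if i = 3 then z else w)"
  have v: "v $ 1 = x" "v $ 2 = y" "v $ 3 = z" "v $ 4 = w"
    by (simp_all add: v_def)
  have "v \<noteq> 0"
    using v Q \<open>m > 0\<close> by (auto simp: bqf_eval_def)
  moreover have "diff_form Q R v = 0"
    by (simp add: diff_form_def v Q R)
  ultimately show "\<not> anisotropic (diff_form Q R)"
    by (auto simp: anisotropic_def)
qed

lemma represents_times_square:
  assumes "represents Q m"
  shows "represents Q (m * k\<^sup>2)"
proof -
  obtain x y where "bqf_eval Q x y = m"
    using assms by (auto simp: represents_def)
  then have "bqf_eval Q (k * x) (k * y) = m * k\<^sup>2"
    by (auto simp: bqf_eval_def algebra_simps power2_eq_square)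
  then show ?thesis
    by (auto simp: represents_def)
qed

text \<open>The set of values of a form of discriminant \<open>D\<close> is closed under multiplication by norms from
  the order \<open>\<int>[\<surd>D]\<close>, since this order acts on the lattice of the form: \<open>\<surd>D\<close> acts by
  \<open>(x, y) \<mapsto> (- b x - 2 c y, 2 a x + b y)\<close>, whose square is multiplication by \<open>D\<close>, and which
  multiplies the form by \<open>- D\<close>.\<close>

lemma represents_times_norm:
  assumes "represents Q m"
  shows "represents Q ((X\<^sup>2 - bqf_disc Q * Y\<^sup>2) * m)"
proof -
  obtain x y where m: "bqf_eval Q x y = m"
    using assms by (auto simp: represents_def)
  let ?a = "coeff_a Q" and ?b = "coeff_b Q" and ?c = "coeff_c Q"
  have "bqf_eval Q (X * x + Y * (- ?b * x - 2 * ?c * y)) (X * y + Y * (2 * ?a * x + ?b * y))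
      = (X\<^sup>2 - bqf_disc Q * Y\<^sup>2) * bqf_eval Q x y"
    unfolding bqf_eval_def bqf_disc_def by algebra
  then show ?thesis
    unfolding represents_def m by blast
qed

text \<open>Completing the square: \<open>Q\<close> itself is the norm form up to the factor \<open>4 a\<close>.\<close>

lemma represented_value_is_norm:
  assumes "represents Q m"
  shows "\<exists>X Y. 4 * coeff_a Q * m = X\<^sup>2 - bqf_disc Q * Y\<^sup>2"
proof -
  obtain x y where m: "bqf_eval Q x y = m"
    using assms by (auto simp: represents_def)
  have "4 * coeff_a Q * bqf_eval Q x y
      = (2 * coeff_a Q * x + coeff_b Q * y)\<^sup>2 - bqf_disc Q * y\<^sup>2"
    unfolding bqf_eval_def bqf_disc_def by algebra
  then show ?thesis
    unfolding m by blast
qed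

text \<open>The common value \<open>m\<close> makes \<open>4 a m\<close> a norm through \<open>Q\<close>, and multiplying the value \<open>m\<close> of \<open>R\<close> by
  this norm turns the two factors \<open>m\<close> into a square, leaving only \<open>a\<close>.\<close>

lemma common_value_imp_represents_leading_coeff_times_square:
  assumes "bqf_disc Q = bqf_disc R" and "represents Q m" and "represents R m"
  shows "represents R (coeff_a Q * (2 * m)\<^sup>2)"
proof -
  obtain X Y where "4 * coeff_a Q * m = X\<^sup>2 - bqf_disc R * Y\<^sup>2"
    using represented_value_is_norm[OF assms(2)] assms(1) by auto
  then have "represents R (4 * coeff_a Q * m * m)"
    using represents_times_norm[OF assms(3), of X Y] by simp
  then show ?thesis
    by (simp add: power2_eq_square mult_ac)
qed

lemma represents_leading_coeff: "represents Q (coeff_a Q)"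
proof -
  have "bqf_eval Q 1 0 = coeff_a Q"
    by (simp add: bqf_eval_def)
  then show ?thesis
    unfolding represents_def by blast
qed

lemma represents_zero: "represents Q 0"
  using represents_times_square[OF represents_leading_coeff, of Q 0] by simp

lemma pos_def_imp_leading_coeff_pos:
  assumes "bqf_pos_def Q"
  shows "coeff_a Q > 0"
proof -
  have "bqf_eval Q 1 0 > 0"
    using assms by (simp add: bqf_pos_def_def)
  then show ?thesis
    by (simp add: bqf_eval_def)
qed

text \<open>Here the values that a fixed \<open>Q\<close> shares with each single member of a finite family are merged
  into one value shared by the whole family.\<close>

lemma pairwise_common_values_imp_common_value:
  assumes "finite S" and "coeff_a Q > 0"
    and disc: "\<And>R. R \<in> S \<Longrightarrow> bqf_disc R = bqf_disc Q"
    and common: "\<And>R. R \<in> S \<Longrightarrow> \<exists>m>0. represents Q m \<and> represents R m"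
  shows "\<exists>m>0. \<forall>R\<in>S. represents R m"
proof -
  obtain f where f: "\<And>R. R \<in> S \<Longrightarrow> f R > 0 \<and> represents Q (f R) \<and> represents R (f R)"
    using common by metis
  define M where "M = (\<Prod>R\<in>S. 2 * f R)"
  have "M > 0"
    unfolding M_def using f by (intro prod_pos) simp
  have "represents R (coeff_a Q * M\<^sup>2)" if "R \<in> S" for R
  proof -
    have "2 * f R dvd M"
      unfolding M_def using \<open>finite S\<close> that by (rule dvd_prodI)
    then obtain k where "M = 2 * f R * k"
      by (elim dvdE)
    then have "coeff_a Q * M\<^sup>2 = coeff_a Q * (2 * f R)\<^sup>2 * k\<^sup>2"
      by (simp add: power_mult_distrib)
    moreover have "represents R (coeff_a Q * (2 * f R)\<^sup>2)"
      using common_value_imp_represents_leading_coeff_times_square[of Q R "f R"]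
        f[OF that] disc[OF that] by simp
    ultimately show ?thesis
      by (metis represents_times_square)
  qed
  moreover have "coeff_a Q * M\<^sup>2 > 0"
    using \<open>coeff_a Q > 0\<close> \<open>M > 0\<close> by simp
  ultimately show ?thesis
    by blast
qed

theorem theorem1:
  fixes D :: int
  assumes "D < 0"
    and "D mod 4 \<in> {0, 1}"
    and "class_number D \<ge> 2"
  shows "(\<forall>m\<ge>0. (\<forall>Q\<in>forms D. represents Q m) \<longleftrightarrow> m = 0) \<longleftrightarrow>
    (\<exists>Q\<in>forms D. \<exists>R\<in>forms D. Q \<noteq> R \<and> anisotropic (diff_form Q R))"
proof
  assume only_zero: "\<forall>m\<ge>0. (\<forall>Q\<in>forms D. represents Q m) \<longleftrightarrow> m = 0"
  show "\<exists>Q\<in>forms D. \<exists>R\<in>forms D. Q \<noteq> R \<and> anisotropic (diff_form Q R)"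
  proof (rule ccontr)
    assume isotropic: "\<not> ?thesis"
    \<comment> \<open>An infinite set has cardinality \<open>0\<close>, so the bound on the class number yields finiteness.\<close>
    have "finite (forms D)"
      using assms(3) by (intro card_ge_0_finite) (simp add: class_number_def)
    have "forms D \<noteq> {}"
      using assms(3) by (auto simp: class_number_def)
    then obtain Q where Q: "Q \<in> forms D"
      by blast
    have pos_def: "bqf_pos_def R" if "R \<in> forms D" for R
      using that by (simp add: forms_def)
    then have a_pos: "coeff_a Q > 0"
      using Q pos_def_imp_leading_coeff_pos by blast
    have "\<exists>m>0. represents Q m \<and> represents R m" if "R \<in> forms D" for R
    proof (cases "R = Q")
      case True
      then show ?thesis
        using a_pos represents_leading_coeff by blast
    next
      case False
      then have "\<not> anisotropic (diff_form Q R)"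
        using isotropic Q that by auto
      then show ?thesis
        using isotropic_iff_common_positive_value[OF pos_def[OF Q] pos_def[OF that]] by simp
    qed
    moreover have "bqf_disc R = bqf_disc Q" if "R \<in> forms D" for R
      using that Q by (simp add: forms_def)
    ultimately obtain m where "m > 0" and "\<forall>R\<in>forms D. represents R m"
      using pairwise_common_values_imp_common_value[of "forms D" Q] \<open>finite (forms D)\<close> a_pos
      by blast
    then have "m = 0"
      using only_zero order_less_imp_le by blast
    then show False
      using \<open>m > 0\<close> by simp
  qed
next
  assume "\<exists>Q\<in>forms D. \<exists>R\<in>forms D. Q \<noteq> R \<and> anisotropic (diff_form Q R)"
  then obtain Q R where QR: "Q \<in> forms D" "R \<in> forms D" and "anisotropic (diff_form Q R)"
    by blast
  then have no_common: "\<not> (\<exists>m>0. represents Q m \<and> represents R m)"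
    using isotropic_iff_common_positive_value[of Q R] by (auto simp: forms_def)
  show "\<forall>m\<ge>0. (\<forall>Q\<in>forms D. represents Q m) \<longleftrightarrow> m = 0"
  proof (intro allI impI iffI)
    fix m :: int
    assume "m \<ge> 0" and "\<forall>Q\<in>forms D. represents Q m"
    then have "\<not> m > 0"
      using no_common QR by blast
    then show "m = 0"
      using \<open>m \<ge> 0\<close> by simp
  qed (simp add: represents_zero)
qed

end
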